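(* There exists an inhomogeneous Bernoulli product $\mu$ on $\Sigma=\{0,1\}^{\mathbb{N}}$ whose set of phase transitions is dense in $[1,\infty)$; that is, the function $\tau_\mu$ is non-differentiable at every point of some dense subset of $[1,\infty)$.
   Context: Let $\Sigma=\{0,1\}^{\mathbb{N}}$. For $\epsilon_1,\dots,\epsilon_n\in\{0,1\}$ the cylinder $I_{\epsilon_1\dots\epsilon_n}$ is the set of $x=(i_1,i_2,\dots)\in\Sigma$ with $i_1=\epsilon_1,\dots,i_n=\epsilon_n$. $\mathcal{F}_n$ is the collection of the $2^n$ cylinders of generation $n$. An inhomogeneous Bernoulli product is a Borel probability measure $\mu$ on $\Sigma$ such that, for some sequence of weights $(p_n)_{n\ge1}$ with $p_n\in(0,1)$, $\mu(I_{\epsilon_1\dots\epsilon_n})=\prod_{j=1}^n p_j^{1-\epsilon_j}(1-p_j)^{\epsilon_j}$ for all $n$ and all $\epsilon_1,\dots,\epsilon_n\in\{0,1\}$. The $L^q$-spectrum (called simply the spectrum) of $\mu$ is $\tau_\mu(q)=\limsup_{n\to\infty}\frac{1}{n\log 2}\log\left(\sum_{I\in\mathcal{F}_n}\mu(I)^q\right)$. A point $q$ is called a phase transition of $\mu$ if $\tau_\mu'(q)$ does not exist. *)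

theory Defs
  imports "HOL-Probability.Probability"
begin

text \<open>
  The symbol space \<open>{0,1}\<^sup>\<nat>\<close> is the type \<open>nat \<Rightarrow> bool\<close> with its product topology, \<open>False\<close> standing
  for the symbol 0 and \<open>True\<close> for the symbol 1. Coordinates and weights are indexed from 0.
\<close>

definition cylinder :: "bool list \<Rightarrow> (nat \<Rightarrow> bool) set" where
  "cylinder e = {x. \<forall>k < length e. x k = e ! k}"

definition cylinders :: "nat \<Rightarrow> (nat \<Rightarrow> bool) set set" where
  "cylinders n = cylinder ` {e. length e = n}"

definition inhomogeneous_bernoulli_product :: "(nat \<Rightarrow> bool) measure \<Rightarrow> bool" where
  "inhomogeneous_bernoulli_product \<mu> \<longleftrightarrow>
     prob_space \<mu> \<and> sets \<mu> = sets borel \<and>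
     (\<exists>p :: nat \<Rightarrow> real. (\<forall>j. 0 < p j \<and> p j < 1) \<and>
        (\<forall>e. measure \<mu> (cylinder e) = (\<Prod>j<length e. if e ! j then 1 - p j else p j)))"

text \<open>
  The limsup is taken in the extended reals, since for negative \<open>q\<close> it may be infinite.
  The term for \<open>n = 0\<close> (a division by zero) does not affect it.
\<close>

definition Lq_spectrum :: "(nat \<Rightarrow> bool) measure \<Rightarrow> real \<Rightarrow> ereal" where
  "Lq_spectrum \<mu> q =
     limsup (\<lambda>n. ereal (1 / (real n * ln 2) * ln (\<Sum>I\<in>cylinders n. measure \<mu> I powr q)))"

text \<open>
  The derivative at \<open>q\<close> exists if the spectrum is finite near \<open>q\<close> and differentiable there as a
  real function; finiteness is required because \<open>real_of_ereal\<close> sends infinite values to 0.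
\<close>

definition Lq_spectrum_differentiable_at :: "(nat \<Rightarrow> bool) measure \<Rightarrow> real \<Rightarrow> bool" where
  "Lq_spectrum_differentiable_at \<mu> q \<longleftrightarrow>
     (\<forall>\<^sub>F x in nhds q. \<bar>Lq_spectrum \<mu> x\<bar> \<noteq> \<infinity>) \<and>
     (\<lambda>x. real_of_ereal (Lq_spectrum \<mu> x)) differentiable (at q)"

definition phase_transition :: "(nat \<Rightarrow> bool) measure \<Rightarrow> real \<Rightarrow> bool" where
  "phase_transition \<mu> q \<longleftrightarrow> \<not> Lq_spectrum_differentiable_at \<mu> q"

lemma open_cylinder: "open (cylinder e)"
proof -
  define X where "X = (\<lambda>k. if k < length e then {e ! k} else UNIV)"
  have "finite {k. X k \<noteq> UNIV}"
    by (rule finite_subset[of _ "{..<length e}"]) (auto simp: X_def)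
  then have "open (Pi\<^sub>E UNIV X)"
    by (intro open_PiE Topological_Spaces.open_discrete)
  moreover have "cylinder e = Pi\<^sub>E UNIV X"
    by (auto simp: cylinder_def X_def PiE_def Pi_def split: if_splits)
  ultimately show ?thesis
    by simp
qed

end

theory Submission
  imports Defs "HOL-Real_Asymp.Real_Asymp"
begin

text \<open>
  Write \<open>\<beta>(p, q) = log\<^sub>2 (p\<^sup>q + (1 - p)\<^sup>q)\<close>. Since the sum over the cylinders of generation \<open>n\<close>
  factorises, the spectrum of the Bernoulli product with weights \<open>p\<^sub>j\<close> is the upper limit of the
  averages of \<open>\<beta>(p\<^sub>j, q)\<close> over \<open>j < n\<close>. The weights are chosen so that, for \<open>q \<ge> 1\<close>, this upper
  limit is
    \<open>\<tau>(q) = (\<Sum>k. 2\<^bsup>-(k+1)\<^esup> max (\<beta>(a\<^sub>k, q)) ((1 - q) / 2))\<close>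
  for suitable \<open>a\<^sub>k \<in> (0, 1/2)\<close>.

  Each summand is a maximum of a convex function and an affine one. Both vanish at \<open>q = 1\<close>, and
  \<open>\<beta>(a\<^sub>k, \<cdot>)\<close> is strictly convex, so if they meet again at a point \<open>t\<^sub>k > 1\<close> they cross there at a
  positive angle and the maximum has a corner. By the intermediate value theorem \<open>a\<^sub>k\<close> can be
  chosen to make them meet at any prescribed \<open>t\<^sub>k > 1\<close> (\<open>ex_bernoulli_spectrum_eq\<close>). A corner of one
  convex summand cannot be cancelled by the other convex summands, as the second differences show
  (\<open>not_differentiable_two_phase_series\<close>). Letting \<open>t\<^sub>k\<close> enumerate the rationals above 1 gives a
  dense set of phase transitions.

  To realise \<open>\<tau>\<close> as a spectrum, a proportion \<open>2\<^bsup>-(k+1)\<^esup>\<close> of the coordinates is reserved for the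
  \<open>k\<close>-th summand. On a stretch of coordinates these are used in one of two modes: either all of
  them carry the weight \<open>a\<^sub>k\<close>, contributing the average \<open>\<beta>(a\<^sub>k, q)\<close>, or half of them carry \<open>1/2\<close>
  and half a weight close to 0, contributing about \<open>(1 - q) / 2\<close> because \<open>\<beta>(1/2, q) = 1 - q\<close> and
  \<open>\<beta>(0, q) = 0\<close>. A finite list of modes is encoded by a finite pattern of weights. The weight
  sequence runs through all such patterns, repeating each one so often that its average prevails
  over everything before it. The upper limit of the averages is then the supremum over all patterns
  (\<open>limsup_avg_block_sequence\<close>), that is, every summand is maximised separately, with a choice
  of modes that may depend on \<open>q\<close>.
\<close>

section \<open>Bernoulli products and their spectrum\<close>

text \<open>Needed for the product sigma-algebra on bit sequences to be the Borel sigma-algebra.\<close>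
instance bool :: second_countable_topology
proof
  show "\<exists>B :: bool set set. countable B \<and> open = generate_topology B"
  proof (intro exI conjI)
    show "countable (UNIV :: bool set set)" by simp
    show "open = generate_topology (UNIV :: bool set set)"
      by (auto simp: fun_eq_iff Topological_Spaces.open_discrete intro: generate_topology.Basis)
  qed
qed

lemma ex_bernoulli_product:
  fixes p :: "nat \<Rightarrow> real"
  assumes p: "\<And>j. 0 < p j \<and> p j < 1"
  shows "\<exists>\<mu> :: (nat \<Rightarrow> bool) measure. prob_space \<mu> \<and> sets \<mu> = sets borel \<and>
    (\<forall>e. measure \<mu> (cylinder e) = (\<Prod>j<length e. if e ! j then 1 - p j else p j))"
proof -
  define M where "M = (\<lambda>j. measure_pmf (bernoulli_pmf (1 - p j)))"
  interpret product_prob_space M UNIV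
    by (rule product_prob_spaceI) (simp add: M_def prob_space_measure_pmf)
  have "sets (Pi\<^sub>M UNIV M) = sets (Pi\<^sub>M UNIV (\<lambda>_::nat. borel :: bool measure))"
  proof (rule sets_PiM_cong)
    fix j :: nat
    have "X \<in> sets borel" for X :: "bool set"
      by (rule borel_open) (rule Topological_Spaces.open_discrete)
    then show "sets (M j) = sets borel" by (auto simp: M_def)
  qed simp
  also have "\<dots> = sets borel" by (rule sets_PiM_equal_borel)
  finally have sets: "sets (Pi\<^sub>M UNIV M) = sets borel" .
  have cyl: "measure (Pi\<^sub>M UNIV M) (cylinder e) = (\<Prod>j<length e. if e ! j then 1 - p j else p j)" for e
  proof -
    have "cylinder e = prod_emb UNIV M {..<length e} (Pi\<^sub>E {..<length e} (\<lambda>j. {e ! j}))"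
      by (auto simp: cylinder_def prod_emb_def M_def space_PiM PiE_def Pi_def extensional_def restrict_def)
    then have "measure (Pi\<^sub>M UNIV M) (cylinder e) = (\<Prod>j<length e. measure (M j) {e ! j})"
      using measure_PiM_emb[of "{..<length e}" "\<lambda>j. {e ! j}"] by (simp add: M_def)
    also have "\<dots> = (\<Prod>j<length e. if e ! j then 1 - p j else p j)"
    proof (rule prod.cong)
      fix j
      have "0 \<le> p j" "p j \<le> 1" using p[of j] by auto
      then show "measure (M j) {e ! j} = (if e ! j then 1 - p j else p j)"
        by (cases "e ! j") (simp_all add: M_def measure_pmf_single)
    qed simp
    finally show ?thesis .
  qed
  show ?thesis
    by (intro exI[of _ "Pi\<^sub>M UNIV M"] conjI allI prob_space_axioms sets cyl)
qed

lemma cylinder_inj: "inj_on cylinder {e. length e = n}"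
proof (rule inj_onI)
  fix e e' assume len: "e \<in> {e. length e = n}" "e' \<in> {e. length e = n}"
    and eq: "cylinder e = cylinder e'"
  have "(\<lambda>k. k < n \<and> e ! k) \<in> cylinder e" using len by (simp add: cylinder_def)
  then have "(\<lambda>k. k < n \<and> e ! k) \<in> cylinder e'" by (simp only: eq)
  then show "e = e'" using len by (auto simp: cylinder_def intro!: nth_equalityI)
qed

lemma sum_lists_prod_nth:
  fixes h :: "nat \<Rightarrow> bool \<Rightarrow> real"
  shows "(\<Sum>e | length e = n. \<Prod>j<n. h j (e ! j)) = (\<Prod>j<n. h j False + h j True)"
proof (induction n)
  case 0
  then show ?case by simp
next
  case (Suc n)
  define f where "f = (\<lambda>e :: bool list. \<lambda>b. e @ [b])"
  have split: "{e :: bool list. length e = Suc n}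
      = (\<lambda>e. f e False) ` {e. length e = n} \<union> (\<lambda>e. f e True) ` {e. length e = n}"
  proof (intro set_eqI iffI)
    fix e :: "bool list" assume "e \<in> {e. length e = Suc n}"
    then have "e = f (butlast e) (last e)" "length (butlast e) = n"
      by (auto simp: f_def) (metis append_butlast_last_id length_0_conv nat.distinct(1))
    then show "e \<in> (\<lambda>e. f e False) ` {e. length e = n} \<union> (\<lambda>e. f e True) ` {e. length e = n}"
      by (cases "last e") auto
  qed (auto simp: f_def)
  have fin: "finite {e :: bool list. length e = n}"
    using finite_lists_length_eq[of "UNIV :: bool set" n] by simp
  have part: "(\<Sum>e\<in>(\<lambda>e. f e b) ` {e. length e = n}. \<Prod>j<Suc n. h j (e ! j))
      = (\<Prod>j<n. h j False + h j True) * h n b" for b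
  proof -
    have "(\<Sum>e\<in>(\<lambda>e. f e b) ` {e. length e = n}. \<Prod>j<Suc n. h j (e ! j))
        = (\<Sum>e | length e = n. \<Prod>j<Suc n. h j (f e b ! j))"
      by (subst sum.reindex) (auto simp: f_def inj_on_def)
    also have "\<dots> = (\<Sum>e | length e = n. (\<Prod>j<n. h j (e ! j)) * h n b)"
      by (intro sum.cong refl) (auto simp: f_def nth_append)
    finally show ?thesis by (simp add: sum_distrib_right[symmetric] Suc)
  qed
  show ?case
    unfolding split using fin
    by (subst sum.union_disjoint)
      (simp_all only: part finite_imageI, auto simp: f_def algebra_simps)
qed

text \<open>
  The spectrum of the homogeneous Bernoulli measure with weight \<open>p\<close>, the function \<open>\<beta>(p, q)\<close>
  above.
\<close>
definition bernoulli_spectrum :: "real \<Rightarrow> real \<Rightarrow> real" where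
  "bernoulli_spectrum p q = log 2 (p powr q + (1 - p) powr q)"

lemma Lq_spectrum_bernoulli_product:
  assumes p: "\<And>j. 0 < p j \<and> p j < 1"
    and cyl: "\<And>e. measure \<mu> (cylinder e) = (\<Prod>j<length e. if e ! j then 1 - p j else p j)"
  shows "Lq_spectrum \<mu> q = limsup (\<lambda>n. ereal ((\<Sum>j<n. bernoulli_spectrum (p j) q) / real n))"
proof -
  have "1 / (real n * ln 2) * ln (\<Sum>I\<in>cylinders n. measure \<mu> I powr q)
      = (\<Sum>j<n. bernoulli_spectrum (p j) q) / real n" for n
  proof -
    have "(\<Sum>I\<in>cylinders n. measure \<mu> I powr q)
        = (\<Sum>e | length e = n. measure \<mu> (cylinder e) powr q)"
      unfolding cylinders_def by (subst sum.reindex[OF cylinder_inj]) simp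
    also have "\<dots> = (\<Sum>e | length e = n. \<Prod>j<n. (if e ! j then 1 - p j else p j) powr q)"
    proof (rule sum.cong[OF refl])
      fix e :: "bool list" assume "e \<in> {e. length e = n}"
      then show "measure \<mu> (cylinder e) powr q = (\<Prod>j<n. (if e ! j then 1 - p j else p j) powr q)"
        using p by (simp add: cyl prod_powr_distrib less_imp_le)
    qed
    also have "\<dots> = (\<Prod>j<n. p j powr q + (1 - p j) powr q)"
      using sum_lists_prod_nth[of "\<lambda>j b. (if b then 1 - p j else p j) powr q" n] by simp
    finally have "ln (\<Sum>I\<in>cylinders n. measure \<mu> I powr q)
        = (\<Sum>j<n. ln (p j powr q + (1 - p j) powr q))"
      using p by (simp add: ln_prod add_pos_pos less_imp_neq[symmetric])
    then show ?thesis
      by (simp add: bernoulli_spectrum_def log_def sum_divide_distrib mult.commute)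
  qed
  then show ?thesis by (simp add: Lq_spectrum_def)
qed

section \<open>The spectrum of a homogeneous Bernoulli measure\<close>

lemma bernoulli_spectrum_half: "bernoulli_spectrum (1/2) q = 1 - q"
proof -
  have "(1/2::real) powr q + (1 - 1/2) powr q = 2 powr (1 - q)"
    by (simp add: powr_diff powr_divide)
  then show ?thesis by (simp add: bernoulli_spectrum_def)
qed

lemma bernoulli_spectrum_bounds:
  assumes "0 < p" "p < 1" "1 \<le> q"
  shows "bernoulli_spectrum p q \<le> 0" "- q \<le> bernoulli_spectrum p q"
proof -
  have "p powr q \<le> p powr 1" "(1 - p) powr q \<le> (1 - p) powr 1"
    using assms by (intro powr_mono'; simp)+
  then have "p powr q + (1 - p) powr q \<le> 1" using assms by simp
  then show "bernoulli_spectrum p q \<le> 0"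
    using assms by (simp add: bernoulli_spectrum_def add_pos_pos)
  \<comment> \<open>one of \<open>p\<close> and \<open>1 - p\<close> is at least \<open>1/2\<close>\<close>
  have "(1/2) powr q \<le> p powr q \<or> (1/2) powr q \<le> (1 - p) powr q"
    using assms by (cases "p \<le> 1/2") (auto intro!: powr_mono2)
  moreover have "0 \<le> p powr q" "0 \<le> (1 - p) powr q" by simp_all
  moreover have "(1/2::real) powr q = 2 powr (- q)" by (simp add: powr_divide powr_minus_divide)
  ultimately have "2 powr (- q) \<le> p powr q + (1 - p) powr q" by linarith
  then show "- q \<le> bernoulli_spectrum p q"
    using assms by (simp add: bernoulli_spectrum_def le_log_iff add_pos_pos)
qed

lemma bernoulli_spectrum_tendsto_0:
  assumes "1 \<le> q"
  shows "(\<lambda>n. bernoulli_spectrum (1 / (real n + 2)) q) \<longlonglongrightarrow> 0"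
proof -
  have lim: "(\<lambda>n. 1 / (real n + 2)) \<longlonglongrightarrow> 0" by real_asymp
  have "(\<lambda>n. (1 / (real n + 2)) powr q + (1 - 1 / (real n + 2)) powr q) \<longlonglongrightarrow> 0 + (1 - 0) powr q"
    using assms by (intro tendsto_add tendsto_zero_powrI[OF lim tendsto_const]
        tendsto_powr tendsto_diff tendsto_const lim) auto
  then have "(\<lambda>n. bernoulli_spectrum (1 / (real n + 2)) q) \<longlonglongrightarrow> log 2 1"
    unfolding bernoulli_spectrum_def by (intro tendsto_log tendsto_const) auto
  then show ?thesis by simp
qed

lemma convex_on_bernoulli_spectrum:
  assumes "0 < p" "p < 1"
  shows "convex_on UNIV (bernoulli_spectrum p)"
proof -
  define t where "t = ln p - ln (1 - p)"
  have eq: "bernoulli_spectrum p q = (q * ln (1 - p) + ln (1 + exp (q * t))) / ln 2" for q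
  proof -
    have "p powr q + (1 - p) powr q = exp (q * ln (1 - p)) * (1 + exp (q * t))"
      using assms by (simp add: powr_def t_def algebra_simps flip: exp_add)
    moreover have "0 < 1 + exp (q * t)" by (simp add: add_pos_pos)
    ultimately show ?thesis by (simp add: bernoulli_spectrum_def log_def ln_mult)
  qed
  show ?thesis
  proof (rule convex_on_realI)
    fix q :: real
    have pos: "0 < 1 + exp (q * t)" by (simp add: add_pos_pos)
    then have "((\<lambda>q. (q * ln (1 - p) + ln (1 + exp (q * t))) / ln 2) has_real_derivative
        (ln (1 - p) + exp (q * t) * t / (1 + exp (q * t))) / ln 2) (at q)"
      by (auto intro!: derivative_eq_intros)
    moreover have "exp (q * t) * t / (1 + exp (q * t)) = t * (1 - 1 / (1 + exp (q * t)))"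
      using pos by (simp add: field_simps)
    ultimately show "(bernoulli_spectrum p has_real_derivative
        (ln (1 - p) + t * (1 - 1 / (1 + exp (q * t)))) / ln 2) (at q)"
      unfolding eq[abs_def] by simp
  next
    fix x y :: real assume "x \<le> y"
    have pos: "0 < 1 + exp (z * t)" for z by (simp add: add_pos_pos)
    have "t * (1 - 1 / (1 + exp (x * t))) \<le> t * (1 - 1 / (1 + exp (y * t)))"
    proof (cases "0 \<le> t")
      case True
      then have "exp (x * t) \<le> exp (y * t)" using \<open>x \<le> y\<close> by (simp add: mult_right_mono)
      then show ?thesis using True pos by (intro mult_left_mono diff_left_mono divide_left_mono) auto
    next
      case False
      then have "exp (y * t) \<le> exp (x * t)" using \<open>x \<le> y\<close> by (simp add: mult_right_mono_neg)
      then show ?thesis using False pos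
        by (intro mult_left_mono_neg diff_left_mono divide_left_mono) auto
    qed
    then show "(ln (1 - p) + t * (1 - 1 / (1 + exp (x * t)))) / ln 2
        \<le> (ln (1 - p) + t * (1 - 1 / (1 + exp (y * t)))) / ln 2"
      by (simp add: divide_right_mono)
  qed simp
qed

text \<open>
  Strict midpoint convexity between \<open>1\<close>, where the spectrum vanishes, and \<open>q\<close>. It is the strict
  Cauchy--Schwarz inequality for the vectors \<open>(p\<^bsup>1/2\<^esup>, (1-p)\<^bsup>1/2\<^esup>)\<close> and
  \<open>(p\<^bsup>q/2\<^esup>, (1-p)\<^bsup>q/2\<^esup>)\<close>, which are linearly independent because \<open>p \<noteq> 1/2\<close> and
  \<open>q \<noteq> 1\<close>.
\<close>
lemma bernoulli_spectrum_midpoint_less: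
  assumes "0 < p" "p < 1/2" "1 < q"
  shows "2 * bernoulli_spectrum p ((1 + q) / 2) < bernoulli_spectrum p q"
proof -
  define m where "m = (1 + q) / 2"
  define P where "P = 1 - p"
  have P: "0 < P" "p < P" using assms by (auto simp: P_def)
  have sq: "(x powr s)\<^sup>2 = x powr (2 * s)" for x s :: real
    by (simp add: power2_eq_square flip: powr_add)
  have mul: "x powr (1/2) * x powr (q/2) = x powr m" for x :: real
    by (simp add: m_def add_divide_distrib flip: powr_add)
  define u v where "u = p powr (1/2) * P powr (q/2)"
    and "v = p powr (q/2) * P powr (1/2)"
  have "p powr ((q - 1) / 2) < P powr ((q - 1) / 2)"
    using assms P by (intro powr_less_mono2) auto
  then have "(p powr (1/2) * P powr (1/2)) * p powr ((q - 1) / 2)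
      < (p powr (1/2) * P powr (1/2)) * P powr ((q - 1) / 2)"
    using assms P by (intro mult_strict_left_mono) auto
  moreover have split: "x powr (q/2) = x powr (1/2) * x powr ((q - 1) / 2)" for x :: real
    by (simp add: diff_divide_distrib flip: powr_add)
  ultimately have "v < u"
    by (simp add: u_def v_def split mult_ac)
  then have "0 < (u - v)\<^sup>2" by simp
  then have "2 * (u * v) < u\<^sup>2 + v\<^sup>2" by (simp add: power2_diff)
  moreover have "u\<^sup>2 = p * P powr q" "v\<^sup>2 = p powr q * P"
    using assms P by (simp_all add: u_def v_def power_mult_distrib sq)
  moreover have "u * v = p powr m * P powr m"
    by (simp add: u_def v_def mult_ac flip: mul)
  moreover have "(x powr m)\<^sup>2 = x * x powr q" if "0 < x" for x :: real
  proof -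
    have "2 * m = 1 + q" by (simp add: m_def)
    then show ?thesis using that by (simp add: sq powr_add)
  qed
  ultimately have "(p powr m + P powr m)\<^sup>2 < (p + P) * (p powr q + P powr q)"
    using assms P by (simp add: power2_sum algebra_simps)
  then have lt: "(p powr m + P powr m)\<^sup>2 < p powr q + P powr q" by (simp add: P_def)
  have pos: "0 < p powr m + P powr m" using assms P by (simp add: add_pos_pos)
  have "log 2 ((p powr m + P powr m)\<^sup>2) < log 2 (p powr q + P powr q)"
    using lt pos by (intro log_less) auto
  then show ?thesis
    using pos by (simp add: bernoulli_spectrum_def log_nat_power m_def P_def)
qed

text \<open>
  The value \<open>(1 - q) / 2\<close> lies strictly between the value \<open>1 - q\<close> at \<open>p = 1/2\<close> and the limit 0 as
  \<open>p\<close> tends to 0.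
\<close>
lemma ex_bernoulli_spectrum_eq:
  assumes "1 < q"
  obtains p where "0 < p" "p < 1/2" "bernoulli_spectrum p q = (1 - q) / 2"
proof -
  define f where "f = (\<lambda>p::real. p powr q + (1 - p) powr q)"
  have "f (1/2) = 2 powr (1 - q)" by (simp add: f_def powr_diff powr_divide)
  then have half: "f (1/2) < 2 powr ((1 - q) / 2)" using assms by simp
  have zero: "2 powr ((1 - q) / 2) < f 0"
  proof -
    have "2 powr ((1 - q) / 2) < (2::real) powr 0" using assms by (intro powr_less_mono) auto
    then show ?thesis using assms by (simp add: f_def)
  qed
  have "continuous_on {0..1/2} f" unfolding f_def
    using assms by (intro continuous_intros continuous_on_powr') auto
  then obtain p where p: "0 \<le> p" "p \<le> 1/2" "f p = 2 powr ((1 - q) / 2)"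
    using IVT2'[of f "1/2" "2 powr ((1 - q) / 2)" 0] half zero by auto
  have "p \<noteq> 0" using p(3) zero by auto
  moreover have "p \<noteq> 1/2"
  proof
    assume eq: "p = 1/2"
    show False using p(3) half unfolding eq by linarith
  qed
  moreover have "bernoulli_spectrum p q = (1 - q) / 2"
    using p(3) by (simp add: bernoulli_spectrum_def f_def)
  ultimately show thesis using p(1,2) by (intro that[of p]) simp_all
qed

section \<open>Corners of convex functions\<close>

lemma convex_on_linear_growth:
  fixes D :: "real \<Rightarrow> real"
  assumes "convex_on UNIV D" "m < r" "D r = 0" "0 \<le> h"
  shows "- D m / (r - m) * h \<le> D (r + h)"
proof -
  \<comment> \<open>\<open>r\<close> is the convex combination of \<open>m\<close> and \<open>r + h\<close> with weights \<open>h / w\<close> and \<open>(r - m) / w\<close>\<close>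
  define w where "w = r + h - m"
  have w: "0 < w" using assms by (simp add: w_def)
  have "D ((h / w) *\<^sub>R m + ((r - m) / w) *\<^sub>R (r + h)) \<le> (h / w) * D m + ((r - m) / w) * D (r + h)"
  proof -
    have "h / w = 1 - (r - m) / w" using w by (simp add: field_simps) (simp add: w_def)
    moreover have "0 \<le> (r - m) / w" "(r - m) / w \<le> 1" using assms w by (auto simp: w_def)
    ultimately show ?thesis using convex_onD[OF assms(1), of "(r - m) / w" m "r + h"] by simp
  qed
  also have "(h / w) *\<^sub>R m + ((r - m) / w) *\<^sub>R (r + h) = r"
  proof -
    have "h * m + (r - m) * (r + h) = r * w" by (simp add: w_def algebra_simps)
    then show ?thesis using w by (simp add: add_divide_distrib[symmetric])
  qed
  finally have "0 \<le> (h * D m + (r - m) * D (r + h)) / w"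
    using assms(3) by (simp add: add_divide_distrib)
  then have "- (D m * h) \<le> D (r + h) * (r - m)"
    using w by (simp add: zero_le_divide_iff mult.commute)
  then have "- (D m * h) / (r - m) \<le> D (r + h)"
    using assms(2) by (subst pos_divide_le_eq) auto
  then show ?thesis by simp
qed

lemma not_differentiable_if_second_difference:
  fixes F :: "real \<Rightarrow> real"
  assumes c: "0 < c" and d: "0 < d"
    and F: "\<And>h. 0 < h \<Longrightarrow> h < d \<Longrightarrow> c * h \<le> F (r + h) + F (r - h) - 2 * F r"
  shows "\<not> F differentiable (at r)"
proof
  assume "F differentiable (at r)"
  then obtain D where "(F has_real_derivative D) (at r)" by (auto simp: real_differentiable_def)
  then have lim: "((\<lambda>h. (F (r + h) - F r) / h) \<longlongrightarrow> D) (at 0)" by (simp add: DERIV_def)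
  have "filterlim (\<lambda>h. - h) (at 0) (at (0::real))"
    using filtermap_at_minus[of "0::real"] by (simp add: filterlim_def)
  from filterlim_compose[OF lim this]
  have "((\<lambda>h. (F (r + - h) - F r) / (- h)) \<longlongrightarrow> D) (at 0)" .
  then have "((\<lambda>h. (F (r + h) - F r) / h - (F (r + - h) - F r) / (- h)) \<longlongrightarrow> D - D) (at 0)"
    using lim by (intro tendsto_diff)
  then have "((\<lambda>h. (F (r + h) - F r) / h - (F (r + - h) - F r) / (- h)) \<longlongrightarrow> 0) (at_right 0)"
    by (auto intro: tendsto_mono at_le)
  moreover have "\<forall>\<^sub>F h in at_right 0. c \<le> (F (r + h) - F r) / h - (F (r + - h) - F r) / (- h)"
    unfolding eventually_at_right_field
  proof (intro exI[of _ d] conjI allI impI d)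
    fix h assume h: "0 < h" "h < d"
    have "(F (r + h) - F r) / h - (F (r + - h) - F r) / (- h) = (F (r + h) + F (r - h) - 2 * F r) / h"
      by (simp add: add_divide_distrib diff_divide_distrib)
    then show "c \<le> (F (r + h) - F r) / h - (F (r + - h) - F r) / (- h)"
      using F[OF h] h by (simp add: pos_le_divide_eq)
  qed
  ultimately have "c \<le> 0" by (rule tendsto_lowerbound) simp
  then show False using c by simp
qed

text \<open>
  The larger of the averages produced by the two modes: constant weight \<open>p\<close>, or weights \<open>1/2\<close> and
  (in the limit) 0 in equal proportion.
\<close>
definition two_phase :: "real \<Rightarrow> real \<Rightarrow> real" where
  "two_phase p q = max (bernoulli_spectrum p q) ((1 - q) / 2)"

lemma two_phase_bounds:
  assumes "0 < p" "p < 1" "1 \<le> q"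
  shows "(1 - q) / 2 \<le> two_phase p q" "two_phase p q \<le> 0"
  using bernoulli_spectrum_bounds[OF assms] assms by (auto simp: two_phase_def)

lemma two_phase_midpoint:
  assumes "0 < p" "p < 1"
  shows "2 * two_phase p q \<le> two_phase p (q + h) + two_phase p (q - h)"
proof -
  have "bernoulli_spectrum p ((1 - 1/2) *\<^sub>R (q + h) + (1/2) *\<^sub>R (q - h))
      \<le> (1 - 1/2) * bernoulli_spectrum p (q + h) + (1/2) * bernoulli_spectrum p (q - h)"
    by (intro convex_onD[OF convex_on_bernoulli_spectrum] assms) auto
  then have "2 * bernoulli_spectrum p q \<le> bernoulli_spectrum p (q + h) + bernoulli_spectrum p (q - h)"
    by (simp add: field_simps)
  moreover have "bernoulli_spectrum p s \<le> two_phase p s" "(1 - s) / 2 \<le> two_phase p s" for s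
    by (simp_all add: two_phase_def)
  from this[of "q + h"] this[of "q - h"]
  have "bernoulli_spectrum p (q + h) \<le> two_phase p (q + h)" "bernoulli_spectrum p (q - h) \<le> two_phase p (q - h)"
    "(1 - (q + h)) / 2 \<le> two_phase p (q + h)" "(1 - (q - h)) / 2 \<le> two_phase p (q - h)" by simp_all
  ultimately have "bernoulli_spectrum p q \<le> (two_phase p (q + h) + two_phase p (q - h)) / 2"
    "(1 - q) / 2 \<le> (two_phase p (q + h) + two_phase p (q - h)) / 2" by (simp_all add: field_simps)
  then have "two_phase p q \<le> (two_phase p (q + h) + two_phase p (q - h)) / 2"
    unfolding two_phase_def[of p q] by (rule max.boundedI)
  then show ?thesis by simp
qed

text \<open>
  At a point \<open>r > 1\<close> where the two modes agree there is a corner. With \<open>D\<close> the difference of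
  the two functions, \<open>D\<close> is convex, vanishes at \<open>r\<close> and is negative at the midpoint \<open>m\<close> of \<open>1\<close> and
  \<open>r\<close>, so it grows at least linearly to the right of \<open>r\<close>. Bounding the maximum from below by
  the convex function at \<open>r + h\<close> and by the affine one at \<open>r - h\<close> yields \<open>D (r + h)\<close>.
\<close>
lemma two_phase_second_difference:
  assumes p: "0 < p" "p < 1/2" and r: "1 < r" "bernoulli_spectrum p r = (1 - r) / 2"
  obtains c where "0 < c" "\<And>h. 0 \<le> h \<Longrightarrow> c * h \<le> two_phase p (r + h) + two_phase p (r - h) - 2 * two_phase p r"
proof -
  define D where "D = (\<lambda>q. bernoulli_spectrum p q + (q - 1) / 2)"
  define m where "m = (1 + r) / 2"
  have "convex_on UNIV (\<lambda>q. (q - 1) / 2 :: real)"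
    by (rule convex_on_realI[where f' = "\<lambda>_. 1/2"]) (auto intro!: derivative_eq_intros)
  then have "convex_on UNIV D"
    unfolding D_def using p by (intro convex_on_add convex_on_bernoulli_spectrum) auto
  moreover have "m < r" "D r = 0" using r(1) by (simp_all add: D_def m_def r(2) add_divide_distrib[symmetric])
  ultimately have growth: "- D m / (r - m) * h \<le> D (r + h)" if "0 \<le> h" for h
    using that by (rule convex_on_linear_growth)
  have "D m < 0"
    using bernoulli_spectrum_midpoint_less[OF p r(1)] r
    by (simp add: D_def m_def field_simps)
  then have "0 < - D m / (r - m)" using \<open>m < r\<close> by (intro divide_pos_pos) simp_all
  moreover have "- D m / (r - m) * h \<le> two_phase p (r + h) + two_phase p (r - h) - 2 * two_phase p r" if "0 \<le> h" for h
  proof -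
    have "bernoulli_spectrum p (r + h) \<le> two_phase p (r + h)" "(1 - (r - h)) / 2 \<le> two_phase p (r - h)"
      "two_phase p r = (1 - r) / 2" using r by (auto simp: two_phase_def)
    then have "D (r + h) \<le> two_phase p (r + h) + two_phase p (r - h) - 2 * two_phase p r"
      by (simp add: D_def field_simps)
    with growth[OF that] show ?thesis by (rule order_trans)
  qed
  ultimately show thesis by (rule that)
qed

section \<open>Concatenating repeated patterns\<close>

lemma periodic_sum_bound:
  fixes f :: "nat \<Rightarrow> real"
  assumes L: "0 < L" and f: "\<And>j. j < L \<Longrightarrow> \<bar>f j\<bar> \<le> C"
  shows "\<bar>(\<Sum>j<n. f (j mod L)) - real n * ((\<Sum>j<L. f j) / real L)\<bar> \<le> 2 * C * real L"
proof (induction n rule: less_induct)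
  case (less n)
  define a where "a = (\<Sum>j<L. f j) / real L"
  have C: "0 \<le> C" using f[OF L] by linarith
  have bound: "\<bar>\<Sum>j<k. f j\<bar> \<le> C * real k" if "k \<le> L" for k
  proof -
    have "\<bar>\<Sum>j<k. f j\<bar> \<le> (\<Sum>j<k. C)"
      using that f by (intro order_trans[OF sum_abs] sum_mono) auto
    then show ?thesis by (simp add: mult.commute)
  qed
  show ?case
  proof (cases "n < L")
    case True
    have "\<bar>a\<bar> \<le> C" using bound[of L] L by (simp add: a_def field_simps)
    then have "\<bar>real n * a\<bar> \<le> C * real n"
      by (simp add: abs_mult mult.commute mult_right_mono)
    moreover have "(\<Sum>j<n. f (j mod L)) = (\<Sum>j<n. f j)"
      using True by (intro sum.cong) auto
    moreover have "C * real n \<le> C * real L" using True C by (simp add: mult_left_mono)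
    ultimately show ?thesis using bound[of n] True unfolding a_def[symmetric] by auto
  next
    case False
    then obtain k where k: "n = k + L" by (metis add.commute le_Suc_ex not_less)
    have "(\<Sum>j<n. f (j mod L)) = (\<Sum>j=0..<L. f (j mod L)) + (\<Sum>j=0+L..<k+L. f (j mod L))"
      using sum.atLeastLessThan_concat[of 0 L n "\<lambda>j. f (j mod L)"]
      by (simp add: k atLeast0LessThan)
    also have "(\<Sum>j=0+L..<k+L. f (j mod L)) = (\<Sum>j<k. f (j mod L))"
      by (subst sum.shift_bounds_nat_ivl) (simp add: atLeast0LessThan)
    also have "(\<Sum>j=0..<L. f (j mod L)) = real L * a"
      using L by (simp add: a_def atLeast0LessThan)
    finally show ?thesis
      using less[of k] L k unfolding a_def[symmetric] by (simp add: algebra_simps)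
  qed
qed

text \<open>
  Given nonempty lists \<open>P 0, P 1, \<dots>\<close>, the sequence \<open>block_sequence P\<close> repeats \<open>P m\<close> periodically
  on the block from \<open>block_start P m\<close> to \<open>block_start P (Suc m)\<close>. The blocks grow so fast that, at
  the end of block \<open>m\<close>, the earlier blocks together with the periods of the current and the next
  pattern make up at most a fraction \<open>1 / Suc m\<close>. The phase of the pattern within a block is taken
  from the absolute position \<open>j\<close>, so a block need not begin at the first entry of its pattern.
\<close>
primrec block_start :: "(nat \<Rightarrow> 'a list) \<Rightarrow> nat \<Rightarrow> nat" where
  "block_start P 0 = 0"
| "block_start P (Suc m) = Suc m * (block_start P m + length (P m) + length (P (Suc m)))"

definition block_index :: "(nat \<Rightarrow> 'a list) \<Rightarrow> nat \<Rightarrow> nat" where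
  "block_index P j = (LEAST m. j < block_start P (Suc m))"

definition block_sequence :: "(nat \<Rightarrow> 'a list) \<Rightarrow> nat \<Rightarrow> 'a" where
  "block_sequence P j = (let w = P (block_index P j) in w ! (j mod length w))"

text \<open>The average of \<open>f\<close> over the entries of a list.\<close>
definition list_avg :: "('a \<Rightarrow> real) \<Rightarrow> 'a list \<Rightarrow> real" where
  "list_avg f xs = sum_list (map f xs) / real (length xs)"

lemma strict_mono_block_start:
  assumes "\<And>m. P m \<noteq> []"
  shows "strict_mono (block_start P)"
proof (rule strict_monoI_Suc)
  fix m
  have "0 < length (P m)" using assms by simp
  then show "block_start P m < block_start P (Suc m)" by simp
qed

lemma block_index_eq:
  assumes "\<And>m. P m \<noteq> []" "block_start P m \<le> j" "j < block_start P (Suc m)"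
  shows "block_index P j = m"
  unfolding block_index_def
proof (rule Least_equality)
  fix i assume i: "j < block_start P (Suc i)"
  show "m \<le> i"
  proof (rule ccontr)
    assume "\<not> m \<le> i"
    then have "block_start P (Suc i) \<le> block_start P m"
      using strict_mono_mono[OF strict_mono_block_start[of P]] assms(1)
      by (auto intro: monoD simp del: block_start.simps)
    then show False using i assms(2) by linarith
  qed
qed (rule assms(3))

lemma ex_block:
  assumes "\<And>m. P m \<noteq> []"
  obtains m where "block_start P m \<le> n" "n < block_start P (Suc m)"
proof -
  have "n < block_start P (Suc n)"
    using strict_mono_imp_increasing[OF strict_mono_block_start[of P]] assms
    by (meson Suc_le_lessD)
  then have least: "n < block_start P (Suc (block_index P n))"
    unfolding block_index_def by (rule LeastI)
  have "block_start P (block_index P n) \<le> n"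
  proof (cases "block_index P n")
    case (Suc i)
    then have "\<not> n < block_start P (Suc i)"
      unfolding block_index_def by (metis lessI not_less_Least)
    then show ?thesis using Suc by (simp only: not_less)
  qed simp
  then show thesis using least by (rule that)
qed

lemma block_sequence_in_set:
  assumes "\<And>m. P m \<noteq> []"
  shows "\<exists>m. block_sequence P j \<in> set (P m)"
proof
  show "block_sequence P j \<in> set (P (block_index P j))"
    using assms[of "block_index P j"] by (simp add: block_sequence_def Let_def)
qed

lemma block_sum_bound:
  assumes P: "\<And>m. P m \<noteq> []" and f: "\<And>m x. x \<in> set (P m) \<Longrightarrow> \<bar>f x\<bar> \<le> C"
    and n: "block_start P m \<le> n" "n \<le> block_start P (Suc m)"
  shows "\<bar>(\<Sum>j<n. f (block_sequence P j)) - (\<Sum>j<block_start P m. f (block_sequence P j))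
      - real (n - block_start P m) * list_avg f (P m)\<bar> \<le> 4 * C * real (length (P m))"
proof -
  define N L S where "N = block_start P m" and "L = length (P m)"
    and "S = (\<lambda>n. \<Sum>j<n. f (P m ! (j mod L)))"
  have avg: "list_avg f (P m) = (\<Sum>j<L. f (P m ! j)) / real L"
    by (simp add: list_avg_def L_def sum_list_sum_nth atLeast0LessThan)
  have S: "\<bar>S k - real k * list_avg f (P m)\<bar> \<le> 2 * C * real L" for k
    unfolding S_def avg by (rule periodic_sum_bound) (use P f[OF nth_mem] in \<open>auto simp: L_def\<close>)
  have diff: "(\<Sum>j<n. g j) - (\<Sum>j<N. g j) = (\<Sum>j=N..<n. g j)" for g :: "nat \<Rightarrow> real"
    using sum.atLeastLessThan_concat[of 0 N n g] n by (simp add: N_def atLeast0LessThan)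
  have "(\<Sum>j<n. f (block_sequence P j)) - (\<Sum>j<N. f (block_sequence P j))
      = (\<Sum>j=N..<n. f (P m ! (j mod L)))"
    unfolding diff
  proof (intro sum.cong refl)
    fix j assume "j \<in> {N..<n}"
    then have "block_index P j = m"
      using n by (intro block_index_eq P) (auto simp: N_def simp del: block_start.simps)
    then show "f (block_sequence P j) = f (P m ! (j mod L))"
      by (simp add: block_sequence_def Let_def L_def)
  qed
  also have "\<dots> = S n - S N" by (simp only: diff[symmetric] S_def)
  finally show ?thesis
    using S[of n] S[of N] n by (simp add: N_def L_def of_nat_diff algebra_simps abs_le_iff
        del: block_start.simps)
qed

text \<open>
  At the end of block \<open>m\<close> the average is close to that of \<open>P m\<close>. Inside block \<open>Suc m\<close> it is close
  to a convex combination of the averages of \<open>P m\<close> and \<open>P (Suc m)\<close>, because everything before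
  block \<open>m\<close> is negligible already at the start of block \<open>Suc m\<close>.
\<close>
lemma limsup_avg_block_sequence:
  fixes f :: "'a \<Rightarrow> real"
  assumes P: "\<And>m. P m \<noteq> []" and f: "\<And>m x. x \<in> set (P m) \<Longrightarrow> \<bar>f x\<bar> \<le> C"
    and upper: "\<And>m. list_avg f (P m) \<le> F"
    and lower: "\<And>\<epsilon>. 0 < \<epsilon> \<Longrightarrow> infinite {m. F - \<epsilon> < list_avg f (P m)}"
  shows "limsup (\<lambda>n. ereal ((\<Sum>j<n. f (block_sequence P j)) / real n)) = ereal F"
proof (rule antisym)
  define N where "N = block_start P"
  define L where "L = (\<lambda>m. length (P m))"
  define S where "S = (\<lambda>n. \<Sum>j<n. f (block_sequence P j))"
  have S_eq: "(\<Sum>j<n. f (block_sequence P j)) = S n" for n by (simp add: S_def)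
  define a where "a = (\<lambda>m. list_avg f (P m))"
  have C: "0 \<le> C" using f[of "hd (P 0)" 0] hd_in_set[OF P[of 0]] by linarith
  have sm: "strict_mono N" unfolding N_def by (rule strict_mono_block_start[OF P])
  have N_less: "N m < N (Suc m)" for m using strict_monoD[OF sm] by simp
  have N_Suc: "real (Suc m) * (real (N m) + real (L m) + real (L (Suc m))) = real (N (Suc m))" for m
    by (simp add: N_def L_def algebra_simps)
  have S_abs: "\<bar>S n\<bar> \<le> C * real n" for n
  proof -
    have "\<bar>S n\<bar> \<le> (\<Sum>j<n. C)"
      unfolding S_def
    proof (intro order_trans[OF sum_abs] sum_mono)
      fix j
      obtain m where "block_sequence P j \<in> set (P m)"
        using block_sequence_in_set[of P j] P by blast
      then show "\<bar>f (block_sequence P j)\<bar> \<le> C" by (rule f)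
    qed
    then show ?thesis by (simp add: mult.commute)
  qed
  have block: "\<bar>S n - S (N m) - (real n - real (N m)) * a m\<bar> \<le> 4 * C * real (L m)"
    if "N m \<le> n" "n \<le> N (Suc m)" for m n
    using block_sum_bound[of P f C m n, OF P f] that
    by (simp add: S_def N_def L_def a_def of_nat_diff del: block_start.simps)
  have a_abs: "\<bar>a m\<bar> \<le> C" for m
  proof -
    have "\<bar>sum_list (map f xs)\<bar> \<le> C * real (length xs)" if "set xs \<subseteq> set (P m)" for xs
      using that
    proof (induction xs)
      case (Cons x xs)
      then show ?case using f[of x m] by (simp add: algebra_simps abs_le_iff)
    qed simp
    from this[of "P m"] show ?thesis using P[of m] by (simp add: a_def list_avg_def field_simps abs_le_iff)
  qed
  have F_low: "- C \<le> F" using a_abs[of 0] upper[of 0] unfolding a_def by linarith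
  have up: "S n / real n \<le> F + 4 * C / real (Suc m)" if n: "N (Suc m) \<le> n" "n < N (Suc (Suc m))" for m n
  proof -
    have n0: "0 < n" using n N_less[of m] by linarith
    have "S n \<le> S (N m) + (real (N (Suc m)) - real (N m)) * a m
        + (real n - real (N (Suc m))) * a (Suc m) + 4 * C * real (L m) + 4 * C * real (L (Suc m))"
      using block[of "Suc m" n] block[of m "N (Suc m)"] n N_less[of m]
      by auto
    also have "(real (N (Suc m)) - real (N m)) * a m \<le> (real (N (Suc m)) - real (N m)) * F"
      using N_less[of m] upper
      by (intro mult_left_mono) (auto simp: a_def)
    also have "(real n - real (N (Suc m))) * a (Suc m) \<le> (real n - real (N (Suc m))) * F"
      using n upper by (intro mult_left_mono) (auto simp: a_def)
    finally have "S n \<le> S (N m) + (real n - real (N m)) * F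
        + 4 * C * real (L m) + 4 * C * real (L (Suc m))"
      by (simp add: algebra_simps)
    moreover have "S (N m) \<le> C * real (N m)" using S_abs[of "N m"] by linarith
    moreover have "real (N m) * - C \<le> real (N m) * F" using F_low by (intro mult_left_mono) auto
    moreover have "0 \<le> C * real (N m)" using C by simp
    ultimately have "S n \<le> real n * F + 4 * C * (real (N m) + real (L m) + real (L (Suc m)))"
      by (simp add: algebra_simps)
    also have "real (N m) + real (L m) + real (L (Suc m)) \<le> real n / real (Suc m)"
    proof -
      have "real (Suc m) * (real (N m) + real (L m) + real (L (Suc m))) \<le> real n"
        unfolding N_Suc using n by simp
      then show ?thesis by (simp add: pos_le_divide_eq mult.commute)
    qed
    finally have "S n \<le> real n * F + 4 * C * (real n / real (Suc m))"
      using C by (simp add: mult_left_mono)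
    then show ?thesis using n0 by (simp add: divide_le_eq algebra_simps)
  qed
  have low: "a m - 4 * C / real (Suc m) \<le> S (N (Suc m)) / real (N (Suc m))" for m
  proof -
    have le: "N m \<le> N (Suc m)" using N_less[of m] by simp
    have n0: "0 < N (Suc m)" using N_less[of m] by simp
    have "S (N m) + (real (N (Suc m)) - real (N m)) * a m - 4 * C * real (L m) \<le> S (N (Suc m))"
      using block[of m "N (Suc m)"] le by auto
    moreover have "- (C * real (N m)) \<le> S (N m)" using S_abs[of "N m"] by linarith
    moreover have "real (N m) * a m \<le> real (N m) * C" using a_abs[of m] by (intro mult_left_mono) auto
    moreover have "0 \<le> C * real (N m)" "0 \<le> C * real (L (Suc m))" using C by simp_all
    ultimately have "real (N (Suc m)) * a m
        - 4 * C * (real (N m) + real (L m) + real (L (Suc m))) \<le> S (N (Suc m))"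
      by (simp add: algebra_simps)
    moreover have "real (N m) + real (L m) + real (L (Suc m)) = real (N (Suc m)) / real (Suc m)"
      unfolding N_Suc[symmetric] by simp
    ultimately have "real (N (Suc m)) * a m - 4 * C * (real (N (Suc m)) / real (Suc m)) \<le> S (N (Suc m))"
      by simp
    then show ?thesis using n0 by (simp add: le_divide_eq algebra_simps)
  qed
  have small: "\<forall>\<^sub>F m in sequentially. 4 * C / real (Suc m) < \<epsilon>" if "0 < \<epsilon>" for \<epsilon>
  proof -
    have "(\<lambda>m. 4 * C / real (Suc m)) \<longlonglongrightarrow> 0"
      by (rule LIMSEQ_Suc[OF lim_const_over_n])
    then show ?thesis using that by (rule order_tendstoD)
  qed
  show "limsup (\<lambda>n. ereal ((\<Sum>j<n. f (block_sequence P j)) / real n)) \<le> ereal F"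
    unfolding S_eq
  proof (rule ereal_le_epsilon2)
    fix \<epsilon> :: real assume "0 < \<epsilon>"
    then obtain m0 where m0: "\<And>m. m \<ge> m0 \<Longrightarrow> 4 * C / real (Suc m) < \<epsilon>"
      using small[of \<epsilon>] by (auto simp: eventually_sequentially)
    have "S n / real n \<le> F + \<epsilon>" if n: "N (Suc m0) \<le> n" for n
    proof -
      obtain k where k: "N k \<le> n" "n < N (Suc k)"
        using ex_block[of P n thesis, OF P] by (simp only: N_def)
      have "\<not> k \<le> m0"
        using n k strict_mono_less_eq[OF sm, of "Suc k" "Suc m0"] by auto
      then obtain m where m: "k = Suc m" "m0 \<le> m" by (cases k) auto
      show ?thesis using up[of m n] k m0[of m] m by simp
    qed
    then have "\<forall>\<^sub>F n in sequentially. ereal (S n / real n) \<le> ereal F + ereal \<epsilon>"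
      by (intro eventually_sequentiallyI[of "N (Suc m0)"]) simp
    then show "limsup (\<lambda>n. ereal (S n / real n)) \<le> ereal F + ereal \<epsilon>"
      by (rule Limsup_bounded)
  qed
  show "ereal F \<le> limsup (\<lambda>n. ereal ((\<Sum>j<n. f (block_sequence P j)) / real n))"
    unfolding S_eq
  proof (rule ccontr)
    assume "\<not> ereal F \<le> limsup (\<lambda>n. ereal (S n / real n))"
    then obtain c where c: "limsup (\<lambda>n. ereal (S n / real n)) < ereal c" "c < F"
      using ereal_dense2[of "limsup (\<lambda>n. ereal (S n / real n))" "ereal F"]
      by (auto simp: not_le)
    then have "\<forall>\<^sub>F n in sequentially. S n / real n < c"
      using Limsup_lessD by fastforce
    then obtain n0 where n0: "\<And>n. n \<ge> n0 \<Longrightarrow> S n / real n < c"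
      by (auto simp: eventually_sequentially)
    obtain m0 where m0: "\<And>m. m \<ge> m0 \<Longrightarrow> 4 * C / real (Suc m) < (F - c) / 2"
      using small[of "(F - c) / 2"] c by (auto simp: eventually_sequentially)
    have "\<exists>m>max n0 m0. F - (F - c) / 2 < a m"
      using lower[of "(F - c) / 2"] c unfolding infinite_nat_iff_unbounded a_def by (simp del: max_less_iff_conj)
    then obtain m where m: "m > max n0 m0" "F - (F - c) / 2 < a m" by blast
    have "n0 \<le> N (Suc m)"
      using strict_mono_imp_increasing[OF sm, of "Suc m"] m by linarith
    then have "S (N (Suc m)) / real (N (Suc m)) < c" by (rule n0)
    with low[of m] have "a m - 4 * C / real (Suc m) < c" by (rule le_less_trans)
    moreover have "4 * C / real (Suc m) < (F - c) / 2" using m by (intro m0) simp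
    moreover have "x - y < c \<Longrightarrow> y < (F - c) / 2 \<Longrightarrow> F - (F - c) / 2 < x \<Longrightarrow> False" for x y :: real
      by (simp add: field_simps)
    ultimately show False using m(2) by blast
  qed
qed

section \<open>Patterns of weights\<close>

text \<open>
  The list of modes \<open>bs\<close> is encoded by a list of \<open>2 * 2 ^ length bs\<close> weights. The \<open>k\<close>-th mode governs
  a proportion \<open>(1/2) ^ Suc k\<close> of it: these entries all equal \<open>a k\<close> if \<open>bs ! k\<close> holds; otherwise
  half of them are \<open>1/2\<close> and half of them \<open>t\<close>, a small positive weight. The remaining two entries
  are \<open>1/2\<close>, the weight with the smallest spectrum for \<open>q \<ge> 1\<close>.
\<close>
fun pattern :: "real \<Rightarrow> (nat \<Rightarrow> real) \<Rightarrow> bool list \<Rightarrow> real list" where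
  "pattern t a [] = [1/2, 1/2]"
| "pattern t a (b # bs) =
     (if b then replicate (2 * 2 ^ length bs) (a 0)
      else replicate (2 ^ length bs) (1/2) @ replicate (2 ^ length bs) t)
     @ pattern t (\<lambda>k. a (Suc k)) bs"

lemma length_pattern: "length (pattern t a bs) = 2 * 2 ^ length bs"
  by (induction t a bs rule: pattern.induct) simp_all

lemma set_pattern: "set (pattern t a bs) \<subseteq> insert t (insert (1/2) (range a))"
  by (induction t a bs rule: pattern.induct) (auto simp: image_subset_iff)

lemma list_avg_pattern_Nil: "list_avg f (pattern t a []) = f (1/2)"
  by (simp add: list_avg_def)

lemma list_avg_pattern_Cons:
  "list_avg f (pattern t a (b # bs))
     = (if b then f (a 0) else (f (1/2) + f t) / 2) / 2 + list_avg f (pattern t (\<lambda>k. a (Suc k)) bs) / 2"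
  by (simp add: list_avg_def length_pattern sum_list_replicate field_simps)

text \<open>
  The largest average over patterns with \<open>n\<close> modes, up to the error caused by \<open>t\<close>; the last term
  comes from the two entries that no mode governs.
\<close>
definition two_phase_partial_sum :: "(nat \<Rightarrow> real) \<Rightarrow> nat \<Rightarrow> real \<Rightarrow> real" where
  "two_phase_partial_sum a n q = (\<Sum>k<n. (1/2) ^ Suc k * two_phase (a k) q) + (1/2) ^ n * (1 - q)"

lemma two_phase_partial_sum_0: "two_phase_partial_sum a 0 q = 1 - q"
  by (simp add: two_phase_partial_sum_def)

lemma two_phase_partial_sum_Suc:
  "two_phase_partial_sum a (Suc n) q = (two_phase (a 0) q + two_phase_partial_sum (\<lambda>k. a (Suc k)) n q) / 2"
proof -
  have "(\<Sum>k<n. (1/2) ^ Suc (Suc k) * two_phase (a (Suc k)) q)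
      = (\<Sum>k<n. (1/2) ^ Suc k * two_phase (a (Suc k)) q) / 2"
    by (simp add: sum_divide_distrib)
  then show ?thesis
    unfolding two_phase_partial_sum_def sum.lessThan_Suc_shift by (simp add: add_divide_distrib)
qed

lemma list_avg_pattern_le:
  assumes "0 < t" "t < 1" "\<And>k. 0 < a k \<and> a k < 1" "1 \<le> q"
  shows "list_avg (\<lambda>p. bernoulli_spectrum p q) (pattern t a bs)
    \<le> two_phase_partial_sum a (length bs) q"
  using assms(3)
proof (induction bs arbitrary: a)
  case Nil
  then show ?case
    by (simp add: list_avg_pattern_Nil two_phase_partial_sum_0 bernoulli_spectrum_half
        del: pattern.simps)
next
  case (Cons b bs)
  have "(if b then bernoulli_spectrum (a 0) q
      else (bernoulli_spectrum (1/2) q + bernoulli_spectrum t q) / 2) \<le> two_phase (a 0) q"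
    using bernoulli_spectrum_bounds(1)[OF assms(1,2,4)]
    by (simp add: bernoulli_spectrum_half two_phase_def le_max_iff_disj)
  moreover have "list_avg (\<lambda>p. bernoulli_spectrum p q) (pattern t (\<lambda>k. a (Suc k)) bs)
      \<le> two_phase_partial_sum (\<lambda>k. a (Suc k)) (length bs) q"
    using Cons by simp
  ultimately show ?case
    unfolding list_avg_pattern_Cons length_Cons two_phase_partial_sum_Suc add_divide_distrib
    by (intro add_mono divide_right_mono) auto
qed

text \<open>The modes that are optimal for the given \<open>q\<close> attain the bound up to the spectrum at \<open>t\<close>.\<close>
lemma list_avg_pattern_ge:
  assumes "0 < t" "t < 1" "\<And>k. 0 < a k \<and> a k < 1" "1 \<le> q"
  shows "two_phase_partial_sum a n q + bernoulli_spectrum t q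
    \<le> list_avg (\<lambda>p. bernoulli_spectrum p q)
        (pattern t a (map (\<lambda>k. (1 - q) / 2 \<le> bernoulli_spectrum (a k) q) [0..<n]))"
  using assms(3)
proof (induction n arbitrary: a)
  case 0
  then show ?case
    using bernoulli_spectrum_bounds(1)[OF assms(1,2,4)]
    by (simp add: list_avg_pattern_Nil two_phase_partial_sum_0 bernoulli_spectrum_half del: pattern.simps)
next
  case (Suc n)
  let ?b = "\<lambda>k. (1 - q) / 2 \<le> bernoulli_spectrum (a k) q"
  have "two_phase (a 0) q + bernoulli_spectrum t q \<le> (if ?b 0 then bernoulli_spectrum (a 0) q
      else (bernoulli_spectrum (1/2) q + bernoulli_spectrum t q) / 2)"
  proof (cases "?b 0")
    case True
    then show ?thesis
      using bernoulli_spectrum_bounds(1)[OF assms(1,2,4)] by (simp add: two_phase_def max_absorb1)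
  next
    case False
    then have "two_phase (a 0) q = (1 - q) / 2" by (simp add: two_phase_def max_absorb2)
    then show ?thesis
      using bernoulli_spectrum_bounds(1)[OF assms(1,2,4)]
      by (simp only: False if_False bernoulli_spectrum_half) (simp add: field_simps)
  qed
  moreover have "two_phase_partial_sum (\<lambda>k. a (Suc k)) n q + bernoulli_spectrum t q
      \<le> list_avg (\<lambda>p. bernoulli_spectrum p q) (pattern t (\<lambda>k. a (Suc k)) (map (\<lambda>k. ?b (Suc k)) [0..<n]))"
    using Suc by simp
  ultimately have "(two_phase (a 0) q + bernoulli_spectrum t q) / 2
      + (two_phase_partial_sum (\<lambda>k. a (Suc k)) n q + bernoulli_spectrum t q) / 2
      \<le> list_avg (\<lambda>p. bernoulli_spectrum p q) (pattern t a (map ?b [0..<Suc n]))"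
    unfolding map_upt_Suc list_avg_pattern_Cons by (intro add_mono divide_right_mono) simp_all
  then show ?case by (simp only: two_phase_partial_sum_Suc) (simp add: field_simps)
qed

text \<open>
  An enumeration of the patterns of all finite lists of modes. The small weight tends to 0 as the
  number of modes grows.
\<close>
definition pattern_seq :: "(nat \<Rightarrow> real) \<Rightarrow> nat \<Rightarrow> real list" where
  "pattern_seq a m = (let bs = from_nat m in pattern (1 / (real (length bs) + 2)) a bs)"

lemma pattern_seq_not_Nil: "pattern_seq a m \<noteq> []"
proof -
  have "length (pattern_seq a m) \<noteq> 0" by (simp add: pattern_seq_def Let_def length_pattern)
  then show ?thesis by simp
qed

section \<open>The series of two-phase spectra\<close>

text \<open>The spectrum, for \<open>q \<ge> 1\<close>, of the Bernoulli product built from the patterns.\<close>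
definition two_phase_series :: "(nat \<Rightarrow> real) \<Rightarrow> real \<Rightarrow> real" where
  "two_phase_series a q = (\<Sum>k. (1/2) ^ Suc k * two_phase (a k) q)"

context
  fixes a :: "nat \<Rightarrow> real"
  assumes a: "\<And>k. 0 < a k \<and> a k < 1"
begin

lemma summable_two_phase_series:
  assumes "1 \<le> q"
  shows "summable (\<lambda>k. (1/2) ^ Suc k * two_phase (a k) q)"
proof (rule summable_comparison_test')
  show "summable (\<lambda>k. (1/2::real) ^ Suc k * q)"
    by (intro summable_mult2 iffD2[OF summable_Suc_iff] summable_geometric) simp
  fix k :: nat assume "0 \<le> k"
  have "\<bar>two_phase (a k) q\<bar> \<le> q"
    using two_phase_bounds[of "a k" q] a[of k] assms by (auto simp: abs_le_iff)
  then show "norm ((1/2) ^ Suc k * two_phase (a k) q) \<le> (1/2) ^ Suc k * q"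
    by (simp add: abs_mult)
qed

lemma two_phase_partial_sum_tendsto:
  assumes "1 \<le> q"
  shows "(\<lambda>n. two_phase_partial_sum a n q) \<longlonglongrightarrow> two_phase_series a q"
proof -
  have "(\<lambda>n. two_phase_partial_sum a n q) \<longlonglongrightarrow> two_phase_series a q + 0 * (1 - q)"
    unfolding two_phase_series_def two_phase_partial_sum_def
    by (intro tendsto_add tendsto_mult tendsto_const LIMSEQ_power_zero summable_LIMSEQ
        summable_two_phase_series assms) simp
  then show ?thesis by simp
qed

lemma two_phase_partial_sum_le:
  assumes "1 \<le> q"
  shows "two_phase_partial_sum a n q \<le> two_phase_series a q"
proof -
  have "incseq (\<lambda>n. two_phase_partial_sum a n q)"
  proof (rule incseq_SucI)
    fix n
    have "1 - q \<le> (1 - q) / 2" using assms by simp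
    also have "(1 - q) / 2 \<le> two_phase (a n) q" using a assms by (intro two_phase_bounds) auto
    finally have "(1/2) ^ Suc n * (1 - q) \<le> (1/2) ^ Suc n * two_phase (a n) q"
      by (intro mult_left_mono) auto
    moreover have "(1/2::real) ^ n * (1 - q) = 2 * ((1/2) ^ Suc n * (1 - q))" by simp
    ultimately show "two_phase_partial_sum a n q \<le> two_phase_partial_sum a (Suc n) q"
      unfolding two_phase_partial_sum_def sum.lessThan_Suc by linarith
  qed
  then show ?thesis using two_phase_partial_sum_tendsto[OF assms] by (rule incseq_le)
qed

lemma not_differentiable_two_phase_series:
  assumes "a k < 1/2" "1 < r" "bernoulli_spectrum (a k) r = (1 - r) / 2"
  shows "\<not> two_phase_series a differentiable (at r)"
proof -
  obtain c where c: "0 < c"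
      "\<And>h. 0 \<le> h \<Longrightarrow> c * h \<le> two_phase (a k) (r + h) + two_phase (a k) (r - h) - 2 * two_phase (a k) r"
    using two_phase_second_difference[of "a k" r] a[of k] assms by blast
  show ?thesis
  proof (rule not_differentiable_if_second_difference)
    show "0 < (1/2) ^ Suc k * c" "0 < r - 1" using c assms by simp_all
    fix h assume h: "0 < h" "h < r - 1"
    let ?d = "\<lambda>i. (1/2) ^ Suc i * two_phase (a i) (r + h) + (1/2) ^ Suc i * two_phase (a i) (r - h)
      - 2 * ((1/2) ^ Suc i * two_phase (a i) r)"
    have d: "?d i = (1/2) ^ Suc i * (two_phase (a i) (r + h) + two_phase (a i) (r - h) - 2 * two_phase (a i) r)" for i
      by (simp add: algebra_simps)
    have sum: "?d sums (two_phase_series a (r + h) + two_phase_series a (r - h) - 2 * two_phase_series a r)"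
      unfolding two_phase_series_def using h
      by (intro sums_diff sums_add sums_mult summable_sums summable_two_phase_series) simp_all
    have "(1/2) ^ Suc k * (c * h) \<le> ?d k"
      unfolding d using c(2)[of h] h by (intro mult_left_mono) auto
    also have "\<dots> = (\<Sum>i\<in>{k}. ?d i)" by simp
    also have "\<dots> \<le> (\<Sum>i. ?d i)"
    proof (rule sum_le_suminf)
      show "summable ?d" using sum by (rule sums_summable)
      show "0 \<le> ?d i" for i
        unfolding d using two_phase_midpoint[of "a i" r h] a[of i] by (intro mult_nonneg_nonneg) auto
    qed simp
    also have "\<dots> = two_phase_series a (r + h) + two_phase_series a (r - h) - 2 * two_phase_series a r"
      using sum by (rule sums_unique[symmetric])
    finally show "(1/2) ^ Suc k * c * h
        \<le> two_phase_series a (r + h) + two_phase_series a (r - h) - 2 * two_phase_series a r"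
      by (simp only: mult.assoc)
  qed
qed

lemma pattern_seq_in_unit_interval:
  assumes "x \<in> set (pattern_seq a m)"
  shows "0 < x \<and> x < 1"
proof -
  have "x \<in> insert (1 / (real (length (from_nat m :: bool list)) + 2)) (insert (1/2) (range a))"
    using assms set_pattern unfolding pattern_seq_def Let_def by blast
  then show ?thesis using a by auto
qed

text \<open>
  Every pattern average is at most the sum of the series; patterns with arbitrarily many modes,
  chosen optimally for \<open>q\<close>, come arbitrarily close to it.
\<close>
lemma limsup_avg_pattern_seq:
  assumes q: "1 \<le> q"
  shows "limsup (\<lambda>n. ereal ((\<Sum>j<n. bernoulli_spectrum (block_sequence (pattern_seq a) j) q) / real n))
    = ereal (two_phase_series a q)"
proof (rule limsup_avg_block_sequence[where C = q])
  let ?avg = "list_avg (\<lambda>p. bernoulli_spectrum p q)"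
  show "pattern_seq a m \<noteq> []" for m by (rule pattern_seq_not_Nil)
  show "\<bar>bernoulli_spectrum x q\<bar> \<le> q" if "x \<in> set (pattern_seq a m)" for m x
    using bernoulli_spectrum_bounds[of x q] pattern_seq_in_unit_interval[OF that] q by auto
  show "?avg (pattern_seq a m) \<le> two_phase_series a q" for m
    unfolding pattern_seq_def Let_def using a q
    by (intro order_trans[OF list_avg_pattern_le two_phase_partial_sum_le]) auto
  fix \<epsilon> :: real assume \<epsilon>: "0 < \<epsilon>"
  define opt where "opt = (\<lambda>n. map (\<lambda>k. (1 - q) / 2 \<le> bernoulli_spectrum (a k) q) [0..<n])"
  have "(\<lambda>n. two_phase_partial_sum a n q + bernoulli_spectrum (1 / (real n + 2)) q)
      \<longlonglongrightarrow> two_phase_series a q + 0"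
    by (intro tendsto_add two_phase_partial_sum_tendsto bernoulli_spectrum_tendsto_0 q)
  then have "\<forall>\<^sub>F n in sequentially. two_phase_series a q - \<epsilon>
      < two_phase_partial_sum a n q + bernoulli_spectrum (1 / (real n + 2)) q"
    by (rule order_tendstoD) (use \<epsilon> in simp)
  then obtain n0 where n0: "\<And>n. n0 \<le> n \<Longrightarrow> two_phase_series a q - \<epsilon>
      < two_phase_partial_sum a n q + bernoulli_spectrum (1 / (real n + 2)) q"
    unfolding eventually_sequentially by blast
  have "(\<lambda>n. to_nat (opt n)) ` {n0..} \<subseteq> {m. two_phase_series a q - \<epsilon> < ?avg (pattern_seq a m)}"
  proof clarify
    fix n assume "n0 \<le> n"
    note n0[OF this]
    also have "two_phase_partial_sum a n q + bernoulli_spectrum (1 / (real n + 2)) q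
        \<le> ?avg (pattern_seq a (to_nat (opt n)))"
      unfolding pattern_seq_def Let_def from_nat_to_nat
      using list_avg_pattern_ge[of "1 / (real n + 2)" a q n] a q by (simp add: opt_def)
    finally show "two_phase_series a q - \<epsilon> < ?avg (pattern_seq a (to_nat (opt n)))" .
  qed
  moreover have "infinite ((\<lambda>n. to_nat (opt n)) ` {n0..})"
  proof
    assume "finite ((\<lambda>n. to_nat (opt n)) ` {n0..})"
    moreover have "inj_on (\<lambda>n. to_nat (opt n)) {n0..}"
    proof (rule inj_onI)
      fix n n' assume "to_nat (opt n) = to_nat (opt n')"
      then have "length (opt n) = length (opt n')" by simp
      then show "n = n'" by (simp add: opt_def)
    qed
    ultimately show False using infinite_Ici finite_imageD by blast
  qed
  ultimately show "infinite {m. two_phase_series a q - \<epsilon> < ?avg (pattern_seq a m)}"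
    by (rule infinite_super)
qed

end

section \<open>Dense phase transitions\<close>

theorem theorem1p3:
  shows "\<exists>\<mu> :: (nat \<Rightarrow> bool) measure.
           inhomogeneous_bernoulli_product \<mu> \<and>
           {1..} \<subseteq> closure ({q. phase_transition \<mu> q} \<inter> {1..})"
proof -
  \<comment> \<open>the corners \<open>t k\<close> enumerate the rationals above 1\<close>
  define Q where "Q = {r \<in> \<rat>. (1::real) < r}"
  have "2 \<in> Q" by (simp add: Q_def)
  then have Q_ne: "Q \<noteq> {}" by blast
  have Q_countable: "countable Q"
    unfolding Q_def by (rule countable_subset[OF _ countable_rat]) auto
  define t where "t = from_nat_into Q"
  have t_gt_1: "1 < t k" for k
    using from_nat_into[OF Q_ne, of k] by (simp add: t_def Q_def)
  have "\<forall>k. \<exists>p. 0 < p \<and> p < 1/2 \<and> bernoulli_spectrum p (t k) = (1 - t k) / 2"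
  proof
    fix k
    obtain p where "0 < p" "p < 1/2" "bernoulli_spectrum p (t k) = (1 - t k) / 2"
      using t_gt_1 by (rule ex_bernoulli_spectrum_eq)
    then show "\<exists>p. 0 < p \<and> p < 1/2 \<and> bernoulli_spectrum p (t k) = (1 - t k) / 2"
      by (intro exI[of _ p] conjI)
  qed
  from choice[OF this] obtain a where
    "\<forall>k. 0 < a k \<and> a k < 1/2 \<and> bernoulli_spectrum (a k) (t k) = (1 - t k) / 2" ..
  then have a: "\<And>k. 0 < a k" "\<And>k. a k < 1/2"
      "\<And>k. bernoulli_spectrum (a k) (t k) = (1 - t k) / 2"
    by simp_all
  have a_unit: "0 < a k \<and> a k < 1" for k using a(1,2)[of k] by simp
  define p where "p = block_sequence (pattern_seq a)"
  have p: "0 < p j \<and> p j < 1" for j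
  proof -
    obtain m where "p j \<in> set (pattern_seq a m)"
      using block_sequence_in_set[of "pattern_seq a" j, OF pattern_seq_not_Nil] by (auto simp: p_def)
    then show ?thesis by (rule pattern_seq_in_unit_interval[of a, OF a_unit])
  qed
  from ex_bernoulli_product[of p, OF p] obtain \<mu> :: "(nat \<Rightarrow> bool) measure" where
    \<mu>: "prob_space \<mu> \<and> sets \<mu> = sets borel \<and>
      (\<forall>e. measure \<mu> (cylinder e) = (\<Prod>j<length e. if e ! j then 1 - p j else p j))" ..
  then have cyl: "measure \<mu> (cylinder e) = (\<Prod>j<length e. if e ! j then 1 - p j else p j)" for e
    by (elim conjE) (rule spec)
  have spectrum: "Lq_spectrum \<mu> q = ereal (two_phase_series a q)" if "1 \<le> q" for q
    unfolding Lq_spectrum_bernoulli_product[of p \<mu>, OF p cyl] p_def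
    by (rule limsup_avg_pattern_seq[of a, OF a_unit that])
  have transition: "phase_transition \<mu> r" if "r \<in> Q" for r
    unfolding phase_transition_def
  proof
    assume "Lq_spectrum_differentiable_at \<mu> r"
    then have diff: "(\<lambda>x. real_of_ereal (Lq_spectrum \<mu> x)) differentiable (at r)"
      by (simp add: Lq_spectrum_differentiable_at_def)
    have r: "1 < r" using that by (simp add: Q_def)
    have "two_phase_series a differentiable (at r)"
    proof (rule differentiable_transform_within[OF diff])
      show "0 < r - 1" using r by simp
      fix x assume "dist x r < r - 1"
      then have "1 \<le> x" by (auto simp: dist_real_def)
      then show "real_of_ereal (Lq_spectrum \<mu> x) = two_phase_series a x" by (simp add: spectrum)
    qed simp
    moreover obtain k where "t k = r"
      using from_nat_into_surj[OF Q_countable \<open>r \<in> Q\<close>] by (auto simp: t_def)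
    then have "\<not> two_phase_series a differentiable (at r)"
      using not_differentiable_two_phase_series[of a k "t k", OF a_unit a(2) t_gt_1 a(3)] by simp
    ultimately show False by contradiction
  qed
  have "{1..} \<subseteq> closure ({q. phase_transition \<mu> q} \<inter> {1..})"
  proof
    fix x :: real assume x: "x \<in> {1..}"
    show "x \<in> closure ({q. phase_transition \<mu> q} \<inter> {1..})"
      unfolding closure_approachable
    proof (intro allI impI)
      fix e :: real assume "0 < e"
      then obtain r where r: "r \<in> \<rat>" "x < r" "r < x + e" using Rats_dense_in_real[of x "x + e"] by auto
      then have "r \<in> Q" using x by (simp add: Q_def)
      then show "\<exists>y\<in>{q. phase_transition \<mu> q} \<inter> {1..}. dist y x < e"
        using r x transition by (intro bexI[of _ r]) (auto simp: dist_real_def)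
    qed
  qed
  moreover have "inhomogeneous_bernoulli_product \<mu>"
    unfolding inhomogeneous_bernoulli_product_def
    using \<mu> p by (intro conjI exI[of _ p]) simp_all
  ultimately show ?thesis by blast
qed

end
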